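(* Let $\Omega\subset\mathbb{R}^d$ be compact, let $\varepsilon\ge 0$, and let $\hat\rho_n=\frac1n\sum_{i=1}^n\delta_{\mathbf{x}_i}$ be an empirical probability measure with $\mathbf{x}_1,\dots,\mathbf{x}_n\in\Omega$. Then the map $T\mapsto\mathcal{M}^2_{\hat\rho_n,\varepsilon}(T)$ is convex on vector fields $T:\Omega\to\Omega$; that is, for all $T_0,T_1:\Omega\to\Omega$ and $t\in[0,1]$ such that $(1-t)T_0+tT_1$ takes values in $\Omega$, $$\mathcal{M}^2_{\hat\rho_n,\varepsilon}\big((1-t)T_0+tT_1\big)\le(1-t)\,\mathcal{M}^2_{\hat\rho_n,\varepsilon}(T_0)+t\,\mathcal{M}^2_{\hat\rho_n,\varepsilon}(T_1).$$
   Context: The cost is the squared Euclidean cost $c(\mathbf{x},\mathbf{y})=\|\mathbf{x}-\mathbf{y}\|_2^2$. The (entropic) empirical Monge gap of $T:\Omega\to\Omega$ is $$\mathcal{M}^2_{\hat\rho_n,\varepsilon}(T)=\frac1n\sum_{i=1}^n\|\mathbf{x}_i-T(\mathbf{x}_i)\|_2^2-W_{\ell_2^2,\varepsilon}(\hat\rho_n,T\sharp\hat\rho_n),$$ where $T\sharp\hat\rho_n=\frac1n\sum_{j=1}^n\delta_{T(\mathbf{x}_j)}$ and $$W_{\ell_2^2,\varepsilon}(\hat\rho_n,T\sharp\hat\rho_n)=\min_{\mathbf{P}\in U_n}\ \langle\mathbf{P},\mathbf{C}\rangle-\varepsilon H(\mathbf{P}),\qquad \mathbf{C}_{ij}=\|\mathbf{x}_i-T(\mathbf{x}_j)\|_2^2.$$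 Here $U_n=\{\mathbf{P}\in\mathbb{R}^{n\times n}_+:\ \mathbf{P}\mathbf{1}_n=\tfrac1n\mathbf{1}_n,\ \mathbf{P}^\top\mathbf{1}_n=\tfrac1n\mathbf{1}_n\}$, $\langle\cdot,\cdot\rangle$ is the Frobenius inner product, and $H(\mathbf{P})=-\sum_{i,j=1}^n\mathbf{P}_{ij}\log\mathbf{P}_{ij}$ (with $0\log 0=0$). *)

theory Defs
  imports "HOL-Analysis.Analysis" "HOL-Real_Asymp.Real_Asymp"
begin

(* An empirical measure (1/n) * (sum of the Dirac masses at x_1, ..., x_n) is represented by the
   family x of its (not necessarily distinct) atoms, indexed by a finite type of cardinality n.
   The push-forward of this measure under T is then represented by the family
   of the points T (x i). *)

definition transport_polytope :: "(real^'n^'n) set" where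
  "transport_polytope =
     {P. (\<forall>i j. 0 \<le> P $ i $ j)
       \<and> P *v (\<chi> i. 1) = (\<chi> i. 1 / real CARD('n))
       \<and> transpose P *v (\<chi> i. 1) = (\<chi> i. 1 / real CARD('n))}"

(* The convention 0 log 0 = 0 holds automatically. *)
definition coupling_entropy :: "real^'n^'n \<Rightarrow> real" where
  "coupling_entropy P = - (\<Sum>i\<in>UNIV. \<Sum>j\<in>UNIV. P $ i $ j * ln (P $ i $ j))"

definition sq_cost_matrix :: "('n::finite \<Rightarrow> real^'d) \<Rightarrow> ('n \<Rightarrow> real^'d) \<Rightarrow> real^'n^'n" where
  "sq_cost_matrix x y = (\<chi> i j. (norm (x i - y j))\<^sup>2)"

(* The inner product of the type real^'n^'n is the Frobenius inner product.
   The infimum is a minimum, see entropic_W_attained. *)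
definition entropic_W :: "real \<Rightarrow> ('n::finite \<Rightarrow> real^'d) \<Rightarrow> ('n \<Rightarrow> real^'d) \<Rightarrow> real" where
  "entropic_W \<epsilon> x y =
     (INF P\<in>transport_polytope. P \<bullet> sq_cost_matrix x y - \<epsilon> * coupling_entropy P)"

definition empirical_Monge_gap ::
    "('n::finite \<Rightarrow> real^'d) \<Rightarrow> real \<Rightarrow> (real^'d \<Rightarrow> real^'d) \<Rightarrow> real" where
  "empirical_Monge_gap x \<epsilon> T =
     1 / real CARD('n) * (\<Sum>i\<in>UNIV. (norm (x i - T (x i)))\<^sup>2) - entropic_W \<epsilon> x (\<lambda>i. T (x i))"

lemma transport_polytope_iff:
  fixes P :: "real^'n^'n"
  shows "P \<in> transport_polytope \<longleftrightarrow>
     (\<forall>i j. 0 \<le> P $ i $ j) \<and> (\<forall>i. (\<Sum>j\<in>UNIV. P $ i $ j) = 1 / real CARD('n))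
       \<and> (\<forall>j. (\<Sum>i\<in>UNIV. P $ i $ j) = 1 / real CARD('n))"
  by (simp add: transport_polytope_def matrix_vector_mult_def transpose_def vec_eq_iff)

lemma transport_polytope_nonempty: "(transport_polytope :: (real^'n^'n) set) \<noteq> {}"
proof -
  have "(\<chi> i j. 1 / real CARD('n) / real CARD('n)) \<in> (transport_polytope :: (real^'n^'n) set)"
    by (simp add: transport_polytope_iff)
  then show ?thesis by blast
qed

lemma compact_transport_polytope: "compact (transport_polytope :: (real^'n^'n) set)"
proof -
  have "closed (transport_polytope :: (real^'n^'n) set)"
  proof -
    have eq: "(transport_polytope :: (real^'n^'n) set) =
        (\<Inter>i. \<Inter>j. {P. 0 \<le> P $ i $ j})
        \<inter> (\<Inter>i. {P. (\<Sum>j\<in>UNIV. P $ i $ j) = 1 / real CARD('n)})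
        \<inter> (\<Inter>j. {P. (\<Sum>i\<in>UNIV. P $ i $ j) = 1 / real CARD('n)})"
      by (auto simp: transport_polytope_iff)
    show ?thesis
      unfolding eq
      by (intro closed_Int closed_INT ballI closed_Collect_le closed_Collect_eq continuous_intros)
  qed
  moreover have "bounded (transport_polytope :: (real^'n^'n) set)"
  proof (rule bounded_subset[OF bounded_cbox])
    show "(transport_polytope :: (real^'n^'n) set)
            \<subseteq> cbox 0 (\<chi> i j. 1 / real CARD('n))"
    proof
      fix P :: "real^'n^'n" assume P: "P \<in> transport_polytope"
      have "P $ i $ j \<le> 1 / real CARD('n)" for i j
      proof -
        have "P $ i $ j \<le> (\<Sum>j\<in>UNIV. P $ i $ j)"
          by (rule member_le_sum) (use P in \<open>auto simp: transport_polytope_iff\<close>)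
        then show ?thesis using P by (simp add: transport_polytope_iff)
      qed
      then show "P \<in> cbox 0 (\<chi> i j. 1 / real CARD('n))"
        using P by (simp add: mem_box_cart interval_cbox_cart transport_polytope_iff
            eucl_le[symmetric] less_eq_vec_def cbox_interval)
    qed
  qed
  ultimately show ?thesis by (simp add: compact_eq_bounded_closed)
qed

lemma continuous_on_x_ln_x: "continuous_on {0..} (\<lambda>x::real. x * ln x)"
proof -
  have "continuous (at x within {0..}) (\<lambda>x::real. x * ln x)" if "x \<ge> 0" for x
  proof (cases "x = 0")
    case True
    have "((\<lambda>x::real. x * ln x) \<longlongrightarrow> 0) (at_right 0)" by real_asymp
    moreover have "at (0::real) within {0..} = at_right 0"
      by (rule at_within_nhd[of _ UNIV]) auto
    ultimately show ?thesis using True by (simp add: continuous_within)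
  next
    case False
    then show ?thesis using that by (intro continuous_intros) auto
  qed
  then show ?thesis by (simp add: continuous_on_eq_continuous_within)
qed

lemma entropic_W_attained:
  fixes x y :: "'n::finite \<Rightarrow> real^'d"
  shows "\<exists>P\<in>transport_polytope.
           entropic_W \<epsilon> x y = P \<bullet> sq_cost_matrix x y - \<epsilon> * coupling_entropy P
         \<and> (\<forall>Q\<in>transport_polytope. P \<bullet> sq_cost_matrix x y - \<epsilon> * coupling_entropy P
                                 \<le> Q \<bullet> sq_cost_matrix x y - \<epsilon> * coupling_entropy Q)"
proof -
  let ?f = "\<lambda>P :: real^'n^'n. P \<bullet> sq_cost_matrix x y - \<epsilon> * coupling_entropy P"
  have ent: "continuous_on transport_polytope (\<lambda>P :: real^'n^'n. P $ i $ j * ln (P $ i $ j))" for i j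
    by (rule continuous_on_compose2[OF continuous_on_x_ln_x])
      (auto intro!: continuous_intros simp: transport_polytope_iff)
  have "continuous_on transport_polytope ?f"
    unfolding coupling_entropy_def
    by (intro continuous_on_diff continuous_on_mult continuous_on_minus continuous_on_sum
        continuous_on_const continuous_on_inner continuous_on_id ent)
  then obtain P where P: "P \<in> transport_polytope" "\<And>Q. Q \<in> transport_polytope \<Longrightarrow> ?f P \<le> ?f Q"
    using continuous_attains_inf[OF compact_transport_polytope transport_polytope_nonempty] by blast
  have "entropic_W \<epsilon> x y = ?f P"
    unfolding entropic_W_def using P by (intro cInf_eq_minimum) auto
  with P show ?thesis by blast
qed

end

theory Submission
  imports Defs
begin

text \<open>
  Expanding the squares, the marginal constraints of a coupling \<open>P\<close> make the terms quadratic
  in \<open>T\<close> cancel between the diagonal cost and \<open>\<langle>P, C\<rangle>\<close>, so their difference is linear in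
  \<open>T\<close>. Hence the Monge gap is a maximum over \<open>P\<close> of affine functions of \<open>T\<close>.
\<close>

text \<open>After expanding the square, the term in \<open>x i\<close> meets only row sums of
  \<open>P\<close> and the term in \<open>y j\<close> only column sums. Both are fixed by the
  marginal constraints, so the coupling itself survives only in the cross term.\<close>

lemma transport_polytope_inner_sq_cost_matrix:
  fixes x y :: "'n::finite \<Rightarrow> real^'d" and P :: "real^'n^'n"
  assumes "P \<in> transport_polytope"
  shows "P \<bullet> sq_cost_matrix x y =
    1 / real CARD('n) * (\<Sum>i\<in>UNIV. (norm (x i))\<^sup>2) + 1 / real CARD('n) * (\<Sum>i\<in>UNIV. (norm (y i))\<^sup>2)
      - 2 * (\<Sum>i\<in>UNIV. \<Sum>j\<in>UNIV. P $ i $ j * (x i \<bullet> y j))"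
proof -
  have row: "(\<Sum>j\<in>UNIV. P $ i $ j) = 1 / real CARD('n)" for i
    using assms by (simp add: transport_polytope_iff)
  have col: "(\<Sum>i\<in>UNIV. P $ i $ j) = 1 / real CARD('n)" for j
    using assms by (simp add: transport_polytope_iff)
  have "P \<bullet> sq_cost_matrix x y = (\<Sum>i\<in>UNIV. \<Sum>j\<in>UNIV. P $ i $ j * (norm (x i - y j))\<^sup>2)"
    by (simp add: inner_vec_def sq_cost_matrix_def)
  also have "\<dots> = (\<Sum>i\<in>UNIV. \<Sum>j\<in>UNIV. P $ i $ j * (norm (x i))\<^sup>2 + P $ i $ j * (norm (y j))\<^sup>2
      - 2 * (P $ i $ j * (x i \<bullet> y j)))"
    by (intro sum.cong refl)
      (simp add: power2_norm_eq_inner inner_diff_left inner_diff_right inner_commute algebra_simps)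
  also have "\<dots> = (\<Sum>i\<in>UNIV. (\<Sum>j\<in>UNIV. P $ i $ j) * (norm (x i))\<^sup>2)
      + (\<Sum>j\<in>UNIV. (\<Sum>i\<in>UNIV. P $ i $ j) * (norm (y j))\<^sup>2)
      - 2 * (\<Sum>i\<in>UNIV. \<Sum>j\<in>UNIV. P $ i $ j * (x i \<bullet> y j))"
    \<comment> \<open>For the terms in \<open>y j\<close>, the sum over \<open>i\<close> has to be
      innermost before a column sum of \<open>P\<close> can be factored out.\<close>
    using sum.swap[of "\<lambda>i j. P $ i $ j * (norm (y j))\<^sup>2" UNIV UNIV]
    by (simp add: sum.distrib sum_subtractf sum_distrib_left sum_distrib_right)
  finally show ?thesis
    by (simp only: row col sum_distrib_left)
qed

text \<open>The quantity maximized over couplings in the Monge gap, written with the quadratic terms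
  already cancelled so that \<open>T\<close> occurs only inside inner products.\<close>

definition coupling_Monge_gap ::
    "real^'n^'n \<Rightarrow> ('n::finite \<Rightarrow> real^'d) \<Rightarrow> real \<Rightarrow> (real^'d \<Rightarrow> real^'d) \<Rightarrow> real" where
  "coupling_Monge_gap P x \<epsilon> T =
     2 * ((\<Sum>i\<in>UNIV. \<Sum>j\<in>UNIV. P $ i $ j * (x i \<bullet> T (x j)))
            - 1 / real CARD('n) * (\<Sum>i\<in>UNIV. x i \<bullet> T (x i)))
       + \<epsilon> * coupling_entropy P"

text \<open>The averages of the squared norms of \<open>x i\<close> and of \<open>T (x i)\<close>
  occur both in the diagonal cost and in the transport cost of \<open>P\<close>, and cancel.\<close>

lemma coupling_Monge_gap_eq:
  fixes x :: "'n::finite \<Rightarrow> real^'d" and P :: "real^'n^'n"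
  assumes "P \<in> transport_polytope"
  shows "coupling_Monge_gap P x \<epsilon> T =
    1 / real CARD('n) * (\<Sum>i\<in>UNIV. (norm (x i - T (x i)))\<^sup>2)
      - (P \<bullet> sq_cost_matrix x (\<lambda>i. T (x i)) - \<epsilon> * coupling_entropy P)"
proof -
  have sq: "(\<Sum>i\<in>UNIV. (norm (x i - T (x i)))\<^sup>2) =
    (\<Sum>i\<in>UNIV. (norm (x i))\<^sup>2) + (\<Sum>i\<in>UNIV. (norm (T (x i)))\<^sup>2) - 2 * (\<Sum>i\<in>UNIV. x i \<bullet> T (x i))"
    by (simp add: power2_norm_eq_inner inner_diff_left inner_diff_right inner_commute
        sum.distrib sum_subtractf sum_distrib_left algebra_simps)
  show ?thesis
    unfolding coupling_Monge_gap_def transport_polytope_inner_sq_cost_matrix[OF assms] sq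
    by (simp add: algebra_simps diff_divide_distrib add_divide_distrib)
qed

text \<open>Inner products are linear in \<open>T\<close>; the entropy term is constant in
  \<open>T\<close> and is reproduced because the weights \<open>1 - t\<close> and \<open>t\<close>
  sum to 1.\<close>

lemma coupling_Monge_gap_affine:
  "coupling_Monge_gap P x \<epsilon> (\<lambda>z. (1 - t) *\<^sub>R T z + t *\<^sub>R S z) =
     (1 - t) * coupling_Monge_gap P x \<epsilon> T + t * coupling_Monge_gap P x \<epsilon> S"
proof -
  have "(\<Sum>i\<in>UNIV. \<Sum>j\<in>UNIV. P $ i $ j * (x i \<bullet> ((1 - t) *\<^sub>R T (x j) + t *\<^sub>R S (x j)))) =
      (1 - t) * (\<Sum>i\<in>UNIV. \<Sum>j\<in>UNIV. P $ i $ j * (x i \<bullet> T (x j)))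
        + t * (\<Sum>i\<in>UNIV. \<Sum>j\<in>UNIV. P $ i $ j * (x i \<bullet> S (x j)))"
    unfolding sum_distrib_left sum.distrib[symmetric]
    by (intro sum.cong refl) (simp only: inner_add_right inner_scaleR_right, algebra)
  moreover have "(\<Sum>i\<in>UNIV. x i \<bullet> ((1 - t) *\<^sub>R T (x i) + t *\<^sub>R S (x i))) =
      (1 - t) * (\<Sum>i\<in>UNIV. x i \<bullet> T (x i)) + t * (\<Sum>i\<in>UNIV. x i \<bullet> S (x i))"
    by (simp add: inner_add_right sum.distrib sum_distrib_left)
  ultimately show ?thesis
    unfolding coupling_Monge_gap_def by algebra
qed

text \<open>Any coupling is a competitor in the minimum defining \<open>entropic_W\<close>, which
  enters the gap with a minus sign.\<close>

lemma coupling_Monge_gap_le: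
  assumes "P \<in> transport_polytope"
  shows "coupling_Monge_gap P x \<epsilon> T \<le> empirical_Monge_gap x \<epsilon> T"
proof -
  have "entropic_W \<epsilon> x (\<lambda>i. T (x i))
      \<le> P \<bullet> sq_cost_matrix x (\<lambda>i. T (x i)) - \<epsilon> * coupling_entropy P"
    using entropic_W_attained[of \<epsilon> x "\<lambda>i. T (x i)"] assms by force
  then show ?thesis
    by (simp add: coupling_Monge_gap_eq[OF assms] empirical_Monge_gap_def)
qed

text \<open>A minimizer for \<open>entropic_W\<close> serves as \<open>P\<close>, so the upper
  envelope of the affine functions is a true maximum.\<close>

lemma empirical_Monge_gap_attained:
  obtains P where "P \<in> transport_polytope"
    and "empirical_Monge_gap x \<epsilon> T = coupling_Monge_gap P x \<epsilon> T"
proof -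
  obtain P where "P \<in> transport_polytope" and
    "entropic_W \<epsilon> x (\<lambda>i. T (x i)) = P \<bullet> sq_cost_matrix x (\<lambda>i. T (x i)) - \<epsilon> * coupling_entropy P"
    using entropic_W_attained by blast
  then show thesis
    by (intro that[of P]) (simp_all add: coupling_Monge_gap_eq empirical_Monge_gap_def)
qed

theorem proposition3p4:
  fixes \<Omega> :: "(real^'d) set" and \<epsilon> t :: real
    and x :: "'n::finite \<Rightarrow> real^'d" and T\<^sub>0 T\<^sub>1 :: "real^'d \<Rightarrow> real^'d"
  assumes "compact \<Omega>" and "\<epsilon> \<ge> 0" and "\<And>i. x i \<in> \<Omega>"
    and "T\<^sub>0 \<in> \<Omega> \<rightarrow> \<Omega>" and "T\<^sub>1 \<in> \<Omega> \<rightarrow> \<Omega>" and "t \<in> {0..1}"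
    and "(\<lambda>z. (1 - t) *\<^sub>R T\<^sub>0 z + t *\<^sub>R T\<^sub>1 z) \<in> \<Omega> \<rightarrow> \<Omega>"
  shows "empirical_Monge_gap x \<epsilon> (\<lambda>z. (1 - t) *\<^sub>R T\<^sub>0 z + t *\<^sub>R T\<^sub>1 z)
           \<le> (1 - t) * empirical_Monge_gap x \<epsilon> T\<^sub>0 + t * empirical_Monge_gap x \<epsilon> T\<^sub>1"
proof -
  \<comment> \<open>\<open>P\<close> is optimal for the interpolated map. For
    \<open>T\<^sub>0\<close> and \<open>T\<^sub>1\<close> it is merely admissible, which yields
    lower bounds on their gaps, to be combined with the nonnegative weights \<open>1 - t\<close> and
    \<open>t\<close>.\<close>
  obtain P where P: "P \<in> transport_polytope"
    and eq: "empirical_Monge_gap x \<epsilon> (\<lambda>z. (1 - t) *\<^sub>R T\<^sub>0 z + t *\<^sub>R T\<^sub>1 z)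
      = coupling_Monge_gap P x \<epsilon> (\<lambda>z. (1 - t) *\<^sub>R T\<^sub>0 z + t *\<^sub>R T\<^sub>1 z)"
    by (rule empirical_Monge_gap_attained)
  show ?thesis
    unfolding eq coupling_Monge_gap_affine
    using \<open>t \<in> {0..1}\<close> by (intro add_mono mult_left_mono coupling_Monge_gap_le P) auto
qed

end
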